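(* Fix a real number $u$. For $k\ge 0$ let $(x)^B_k:=(x-1)(x-3)\cdots(x-2k+1)$, $(x)^B_0:=1$, and let $L:\mathbb{R}[x]\to\mathbb{R}$ be the unique linear functional with $L((x)^B_k)=u^k$ for all $k\ge 0$. For $n\ge 0$ let $B_n^B(u)=\sum_{k=0}^n S^B(n,k)u^k$ be the Bell polynomial of type $B$. Then for each $n\in\mathbb{N}$: (1) $B_n^B(u)=L(x^n)$; (2) $B_{n+1}^B(u)=B_n^B(u)+u\cdot\sum_{j=0}^n 2^{n-j}\binom{n}{j}B_j^B(u)$.
   Context: A set partition of $[n]$ of type $B$ is a set partition of $[\pm n]=\{\pm1,\dots,\pm n\}$ such that whenever $B$ is a block, $-B=\{-b:b\in B\}$ is also a block, and at most one block satisfies $-B=B$ (the zero block). The non-zero blocks come in pairs $\{B,-B\}$; each pair is counted as one representative non-zero block. $S^B(n,k)$ (Stirling number of type $B$ of the second kind) is the number of set partitions of $[n]$ of type $B$ having exactly $k$ representative non-zero blocks. The polynomials $(x)^B_k$, $k\ge0$, form a basis of $\mathbb{R}[x]$. *)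

theory Defs
  imports
    "HOL-Library.Disjoint_Sets"
    "HOL-Computational_Algebra.Polynomial"
begin

definition pm_interval :: "nat \<Rightarrow> int set" where
  "pm_interval n = {- int n..int n} - {0}"

definition typeB_partition :: "nat \<Rightarrow> int set set \<Rightarrow> bool" where
  "typeB_partition n P \<longleftrightarrow>
     partition_on (pm_interval n) P \<and>
     (\<forall>B\<in>P. uminus ` B \<in> P) \<and>
     (\<exists>\<^sub>\<le>\<^sub>1 B. B \<in> P \<and> uminus ` B = B)"

text \<open>Choosing a representative non-zero block amounts to choosing a pair \<open>{B, -B}\<close>,
  so we count the pairs.\<close>

definition nonzero_block_pairs :: "int set set \<Rightarrow> int set set set" where
  "nonzero_block_pairs P = {{B, uminus ` B} | B. B \<in> P \<and> uminus ` B \<noteq> B}"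

definition StirlingB :: "nat \<Rightarrow> nat \<Rightarrow> nat" where
  "StirlingB n k = card {P. typeB_partition n P \<and> card (nonzero_block_pairs P) = k}"

definition BellB :: "nat \<Rightarrow> real \<Rightarrow> real" where
  "BellB n u = (\<Sum>k=0..n. real (StirlingB n k) * u ^ k)"

definition fallB :: "nat \<Rightarrow> real poly" where
  "fallB k = (\<Prod>i=1..k. [:- (2 * real i - 1), 1:])"

definition is_functionalB :: "real \<Rightarrow> (real poly \<Rightarrow> real) \<Rightarrow> bool" where
  "is_functionalB u L \<longleftrightarrow>
     Vector_Spaces.linear smult (*) L \<and> (\<forall>k. L (fallB k) = u ^ k)"

definition functionalB :: "real \<Rightarrow> real poly \<Rightarrow> real" where
  "functionalB u = (THE L. is_functionalB u L)"

text \<open>The rest of this theory shows that \<^const>\<open>functionalB\<close> is well defined.\<close>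

lemma fallB_Suc: "fallB (Suc k) = fallB k * [:- (2 * real k + 1), 1:]"
  by (simp add: fallB_def mult.commute del: mult_pCons_left mult_pCons_right)

lemma fallB_monic: "degree (fallB k) = k \<and> coeff (fallB k) k = 1"
proof (induction k)
  case 0
  show ?case by (simp add: fallB_def)
next
  case (Suc k)
  then have "fallB k \<noteq> 0" by auto
  then have d: "degree (fallB (Suc k)) = Suc k"
    using Suc by (simp add: fallB_Suc degree_mult_eq del: mult_pCons_right)
  have "lead_coeff (fallB (Suc k)) = 1"
    using Suc by (simp only: fallB_Suc lead_coeff_mult) (simp del: mult_pCons_right)
  with d show ?case by simp
qed

lemma linear_poly_functional_iff:
  fixes L :: "real poly \<Rightarrow> real"
  shows "Vector_Spaces.linear smult (*) L \<longleftrightarrow>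
    (\<forall>p q. L (p + q) = L p + L q) \<and> (\<forall>c p. L (smult c p) = c * L p)"
proof -
  have "vector_space (smult :: real \<Rightarrow> real poly \<Rightarrow> real poly)"
    by (rule vector_space.intro) (simp_all add: smult_add_right smult_add_left)
  moreover have "vector_space ((*) :: real \<Rightarrow> real \<Rightarrow> real)"
    by (rule vector_space.intro) (simp_all add: distrib_left distrib_right)
  ultimately show ?thesis
    unfolding Vector_Spaces.linear_iff by blast
qed

lemma linear_poly_functional_expand:
  fixes L :: "real poly \<Rightarrow> real"
  assumes "Vector_Spaces.linear smult (*) L"
  shows "L p = (\<Sum>i\<le>degree p. coeff p i * L (monom 1 i))"
proof -
  have add: "L (p + q) = L p + L q" and scale: "L (smult c p) = c * L p" for p q c
    using assms by (auto simp: linear_poly_functional_iff)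
  have zero: "L 0 = 0" using scale[of 0 0] by simp
  have sum: "L (sum f A) = (\<Sum>i\<in>A. L (f i))" if "finite A" for f :: "nat \<Rightarrow> real poly" and A
    using that by (induction A rule: finite_induct) (auto simp: zero add)
  have "L p = L (\<Sum>i\<le>degree p. smult (coeff p i) (monom 1 i))"
    by (simp add: smult_monom poly_as_sum_of_monoms)
  also have "\<dots> = (\<Sum>i\<le>degree p. coeff p i * L (monom 1 i))"
    by (simp add: sum scale)
  finally show ?thesis .
qed

lemma functionalB_unique:
  assumes "is_functionalB u L" "is_functionalB u M"
  shows "L = M"
proof -
  have lin: "Vector_Spaces.linear smult (*) L" "Vector_Spaces.linear smult (*) M"
    and val: "L (fallB n) = M (fallB n)" for n
    using assms by (auto simp: is_functionalB_def)
  have "L (monom 1 n) = M (monom 1 n)" for n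
  proof (induction n rule: less_induct)
    case (less n)
    have "(\<Sum>i\<le>n. coeff (fallB n) i * L (monom 1 i)) = (\<Sum>i\<le>n. coeff (fallB n) i * M (monom 1 i))"
      using val[of n] linear_poly_functional_expand[OF lin(1), of "fallB n"]
        linear_poly_functional_expand[OF lin(2), of "fallB n"] fallB_monic[of n] by simp
    moreover have "(\<Sum>i<n. coeff (fallB n) i * L (monom 1 i)) = (\<Sum>i<n. coeff (fallB n) i * M (monom 1 i))"
      using less by (intro sum.cong) auto
    ultimately show ?case
      using fallB_monic[of n] by (simp add: lessThan_Suc_atMost[symmetric])
  qed
  then have "L p = M p" for p
    by (simp add: linear_poly_functional_expand[OF lin(1), of p]
        linear_poly_functional_expand[OF lin(2), of p])
  then show ?thesis by (rule ext)
qed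

fun momentB :: "real \<Rightarrow> nat \<Rightarrow> real" where
  "momentB u n = u ^ n - (\<Sum>i<n. coeff (fallB n) i * momentB u i)"

declare momentB.simps [simp del]

lemma is_functionalB_exists: "\<exists>L. is_functionalB u L"
proof -
  define L where "L p = (\<Sum>i\<le>degree p. coeff p i * momentB u i)" for p :: "real poly"
  have L_eq: "L p = (\<Sum>i\<le>N. coeff p i * momentB u i)" if "degree p \<le> N" for p N
    unfolding L_def using that by (intro sum.mono_neutral_left) (auto simp: coeff_eq_0)
  have "L (p + q) = L p + L q" for p q
  proof -
    let ?N = "max (degree p) (degree q)"
    have "degree (p + q) \<le> ?N" by (rule degree_add_le_max)
    then show ?thesis
      using L_eq[of "p + q" ?N] L_eq[of p ?N] L_eq[of q ?N]
      by (simp add: sum.distrib algebra_simps)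
  qed
  moreover have "L (smult c p) = c * L p" for c p
    using L_eq[OF degree_smult_le, of c p] by (simp add: L_def sum_distrib_left mult.assoc)
  moreover have "L (fallB k) = u ^ k" for k
    using fallB_monic[of k]
    by (simp add: L_def lessThan_Suc_atMost[symmetric] momentB.simps[of u k])
  ultimately show ?thesis
    unfolding is_functionalB_def linear_poly_functional_iff by blast
qed

theorem ex1_functionalB: "\<exists>!L. is_functionalB u L"
  using is_functionalB_exists functionalB_unique by blast

theorem is_functionalB_functionalB: "is_functionalB u (functionalB u)"
  unfolding functionalB_def by (rule theI'[OF ex1_functionalB])

end

theory Submission
  imports Defs
begin

text \<open>Deleting \<open>\<plusminus>(n + 1)\<close> from a type \<open>B\<close> partition of \<open>[n + 1]\<close> leaves a type \<open>B\<close> partition \<open>Q\<close>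
  of \<open>[n]\<close>. If \<open>Q\<close> has \<open>c\<close> block pairs, it arises from one partition with \<open>c + 1\<close> pairs, in which
  \<open>n + 1\<close> is a singleton, and from \<open>2 c + 1\<close> partitions with \<open>c\<close> pairs, in which \<open>n + 1\<close> joins
  the possibly empty zero block or one of the \<open>2 c\<close> non-zero blocks. As
  \<open>x (x)\<^sub>c = (x)\<^sub>c\<^sub>+\<^sub>1 + (2 c + 1) (x)\<^sub>c\<close>, it follows that \<open>x\<^sup>n\<close> is the sum of \<open>(x)\<^sub>c\<close>
  over all type \<open>B\<close> partitions of \<open>[n]\<close>, and \<open>L\<close> turns this into (1). For (2), expand
  \<open>(x - 1) x\<^sup>n\<close> in powers of \<open>x - 2\<close> and use \<open>(x)\<^sub>c\<^sub>+\<^sub>1 = (x - 1) (x - 2)\<^sub>c\<close>.\<close>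

section \<open>Negation of sets and elementary facts about type B partitions\<close>

lemma mem_uminus_image_iff [simp]: "x \<in> uminus ` B \<longleftrightarrow> - x \<in> B" for x :: "'a::group_add"
  by force

lemma uminus_image_uminus_image [simp]: "uminus ` uminus ` B = B" for B :: "'a::group_add set"
  by (auto simp: image_image)

lemma uminus_image_Int: "uminus ` (A \<inter> B) = uminus ` A \<inter> uminus ` B" for A :: "'a::group_add set"
  by (rule image_Int) (simp add: inj_on_def)

lemma uminus_image_eq_iff: "uminus ` A = B \<longleftrightarrow> A = uminus ` B" for A :: "'a::group_add set"
  by (metis uminus_image_uminus_image)

lemma mem_pm_interval: "x \<in> pm_interval n \<longleftrightarrow> x \<noteq> 0 \<and> - int n \<le> x \<and> x \<le> int n"
  by (auto simp: pm_interval_def)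

lemma uminus_pm_interval [simp]: "uminus ` pm_interval n = pm_interval n"
  by (auto simp: mem_pm_interval)

lemma pm_interval_Suc: "pm_interval (Suc n) = pm_interval n \<union> {int (Suc n), - int (Suc n)}"
  by (auto simp: mem_pm_interval)

lemma finite_typeB_partitions: "finite {P. typeB_partition n P}"
proof -
  have "{P. typeB_partition n P} \<subseteq> Pow (Pow (pm_interval n))"
    by (auto simp: typeB_partition_def partition_on_def)
  then show ?thesis
    by (rule finite_subset) (simp add: pm_interval_def)
qed

context
  fixes n :: nat and P :: "int set set"
  assumes P: "typeB_partition n P"
begin

lemma typeB_Union: "\<Union>P = pm_interval n"
  using P by (simp add: typeB_partition_def partition_on_def)

lemma typeB_subset: "B \<in> P \<Longrightarrow> B \<subseteq> pm_interval n"
  using typeB_Union by blast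

lemma typeB_nonempty: "B \<in> P \<Longrightarrow> B \<noteq> {}"
  using P by (auto simp: typeB_partition_def partition_on_def)

lemma typeB_uminus: "B \<in> P \<Longrightarrow> uminus ` B \<in> P"
  using P by (simp add: typeB_partition_def)

lemma typeB_eq: "A \<in> P \<Longrightarrow> B \<in> P \<Longrightarrow> x \<in> A \<Longrightarrow> x \<in> B \<Longrightarrow> A = B"
  using P unfolding typeB_partition_def partition_on_def disjoint_def by blast

lemma typeB_zero_unique:
  "A \<in> P \<Longrightarrow> B \<in> P \<Longrightarrow> uminus ` A = A \<Longrightarrow> uminus ` B = B \<Longrightarrow> A = B"
  using P unfolding typeB_partition_def Uniq_def by blast

lemma typeB_finite: "finite P"
  using P by (intro finite_elements[of "pm_interval n"])
    (auto simp: typeB_partition_def pm_interval_def)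

end

lemma typeB_partitionI:
  assumes "\<Union>P = pm_interval n" "{} \<notin> P"
    and "\<And>A B x. A \<in> P \<Longrightarrow> B \<in> P \<Longrightarrow> x \<in> A \<Longrightarrow> x \<in> B \<Longrightarrow> A = B"
    and "\<And>B. B \<in> P \<Longrightarrow> uminus ` B \<in> P"
    and "\<And>A B. A \<in> P \<Longrightarrow> B \<in> P \<Longrightarrow> uminus ` A = A \<Longrightarrow> uminus ` B = B \<Longrightarrow> A = B"
  shows "typeB_partition n P"
proof -
  have "disjoint P"
    using assms(3) by (intro disjointI) (metis disjoint_iff)
  with assms show ?thesis
    unfolding typeB_partition_def partition_on_def Uniq_def by simp
qed

section \<open>Counting non-zero blocks instead of pairs\<close>

definition nonzero_blocks :: "int set set \<Rightarrow> int set set" where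
  "nonzero_blocks P = {B \<in> P. uminus ` B \<noteq> B}"

text \<open>As negation is an involution, a pair is determined by either of its members. So the
  pairs are disjoint two-element sets covering the non-zero blocks. Later counts are made on blocks,
  since adding or removing a block changes \<open>nonzero_blocks\<close> directly.\<close>

lemma card_nonzero_blocks:
  assumes "typeB_partition n P"
  shows "card (nonzero_blocks P) = 2 * card (nonzero_block_pairs P)"
proof -
  have U: "\<Union>(nonzero_block_pairs P) = nonzero_blocks P"
  proof
    show "\<Union>(nonzero_block_pairs P) \<subseteq> nonzero_blocks P"
    proof
      fix A assume "A \<in> \<Union>(nonzero_block_pairs P)"
      then obtain B where "B \<in> P" "uminus ` B \<noteq> B" "A = B \<or> A = uminus ` B"
        by (auto simp: nonzero_block_pairs_def)
      moreover from this have "A \<in> P"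
        using typeB_uminus[OF assms] by blast
      moreover have "uminus ` A \<noteq> A"
        using calculation(2,3) uminus_image_uminus_image[of B] by metis
      ultimately show "A \<in> nonzero_blocks P"
        by (simp add: nonzero_blocks_def)
    qed
    show "nonzero_blocks P \<subseteq> \<Union>(nonzero_block_pairs P)"
      unfolding nonzero_block_pairs_def nonzero_blocks_def by blast
  qed
  have fin: "finite (nonzero_blocks P)"
    using typeB_finite[OF assms] by (simp add: nonzero_blocks_def)
  have "2 * card (nonzero_block_pairs P) = card (\<Union>(nonzero_block_pairs P))"
  proof (rule card_partition)
    show "finite (nonzero_block_pairs P)"
      by (rule finite_UnionD) (simp add: U fin)
    show "finite (\<Union>(nonzero_block_pairs P))"
      using fin by (simp add: U)
    show "card c = 2" if "c \<in> nonzero_block_pairs P" for c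
    proof -
      from that obtain B where "c = {B, uminus ` B}" "uminus ` B \<noteq> B"
        by (auto simp: nonzero_block_pairs_def)
      then show ?thesis by (metis card_2_iff)
    qed
    show "c \<inter> d = {}"
      if cd: "c \<in> nonzero_block_pairs P" "d \<in> nonzero_block_pairs P" "c \<noteq> d" for c d
    proof -
      have pair_eq: "e = {B, uminus ` B}" if "e \<in> nonzero_block_pairs P" "B \<in> e" for e B
      proof -
        from that obtain A where "e = {A, uminus ` A}" "B = A \<or> B = uminus ` A"
          by (auto simp: nonzero_block_pairs_def)
        then show ?thesis
          using uminus_image_uminus_image[of A] by (elim disjE) (simp_all only: insert_commute)
      qed
      have "B \<notin> d" if "B \<in> c" for B
        using pair_eq[OF cd(1) that] pair_eq[OF cd(2), of B] cd(3) by metis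
      then show ?thesis by blast
    qed
  qed
  then show ?thesis by (simp add: U)
qed

section \<open>Encoding a partition of [n + 1] by its restriction and the block of n + 1\<close>

definition restrict_blocks :: "nat \<Rightarrow> int set set \<Rightarrow> int set set" where
  "restrict_blocks n P = (\<inter>) (pm_interval n) ` P - {{}}"

definition top_block :: "nat \<Rightarrow> int set set \<Rightarrow> int set" where
  "top_block n P = (THE B. B \<in> P \<and> int (Suc n) \<in> B)"

text \<open>The possible blocks of \<open>n + 1\<close> in a type \<open>B\<close> partition of \<open>[n + 1]\<close> that restricts
  to \<open>Q\<close>.\<close>

definition admissible :: "nat \<Rightarrow> int set set \<Rightarrow> int set set" where
  "admissible n Q = {A. int (Suc n) \<in> A \<and> A \<subseteq> pm_interval (Suc n) \<and>
     pm_interval n \<inter> A \<in> insert {} Q \<and>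
     (if uminus ` A = A then \<forall>B\<in>Q. uminus ` B = B \<longrightarrow> B = pm_interval n \<inter> A
      else A \<inter> uminus ` A = {})}"

text \<open>Intended inverse of the map from \<open>P\<close> to \<open>restrict_blocks n P\<close>
  and \<open>top_block n P\<close>. The traces of \<open>A\<close> and \<open>-A\<close> on
  \<open>pm_interval n\<close> are the blocks of \<open>Q\<close> that absorb n + 1 and -(n + 1). An
  empty trace is no block of \<open>Q\<close> and removes nothing, so one formula covers new and
  enlarged blocks.\<close>

definition extend_blocks :: "nat \<Rightarrow> int set set \<Rightarrow> int set \<Rightarrow> int set set" where
  "extend_blocks n Q A =
     (Q - {pm_interval n \<inter> A, pm_interval n \<inter> uminus ` A}) \<union> {A, uminus ` A}"

section \<open>Extending a partition of [n] by an admissible block\<close>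

context
  fixes n :: nat and Q :: "int set set" and A :: "int set"
  assumes Q: "typeB_partition n Q" and A: "A \<in> admissible n Q"
begin

private lemma A_simps: "int (Suc n) \<in> A" "A \<subseteq> pm_interval (Suc n)"
    "pm_interval n \<inter> A \<in> insert {} Q" "pm_interval n \<inter> uminus ` A \<in> insert {} Q"
proof -
  show *: "int (Suc n) \<in> A" "A \<subseteq> pm_interval (Suc n)" "pm_interval n \<inter> A \<in> insert {} Q"
    using A by (auto simp: admissible_def)
  have "uminus ` (pm_interval n \<inter> A) \<in> insert {} Q"
    using * typeB_uminus[OF Q] by blast
  then show "pm_interval n \<inter> uminus ` A \<in> insert {} Q"
    by (simp only: uminus_image_Int uminus_pm_interval)
qed

private lemma A_cases: "uminus ` A = A \<or> A \<inter> uminus ` A = {}"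
  using A by (auto simp: admissible_def split: if_splits)

private lemma disjoint_A:
  assumes "B \<in> Q" "B \<noteq> pm_interval n \<inter> A"
  shows "B \<inter> A = {}"
proof (rule ccontr)
  assume "B \<inter> A \<noteq> {}"
  then obtain x where "x \<in> B" "x \<in> A" by auto
  with typeB_subset[OF Q \<open>B \<in> Q\<close>] have "x \<in> pm_interval n \<inter> A" by auto
  with assms A_simps(3) typeB_eq[OF Q, of B _ x] \<open>x \<in> B\<close> show False by blast
qed

private lemma disjoint_uminus_A:
  assumes "B \<in> Q" "B \<noteq> pm_interval n \<inter> uminus ` A"
  shows "B \<inter> uminus ` A = {}"
proof -
  \<comment> \<open>Negating both sets reduces the claim to \<open>disjoint_A\<close> for the block
    \<open>-B\<close>.\<close>
  have "uminus ` B \<inter> A = {}"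
    using assms by (intro disjoint_A typeB_uminus[OF Q])
      (auto simp: uminus_image_eq_iff uminus_image_Int)
  then show ?thesis by force
qed

text \<open>The blocks kept from \<open>Q\<close> miss \<open>A\<close> and \<open>-A\<close>, which
  are themselves equal or disjoint. If \<open>A\<close> is symmetric, admissibility forces any zero
  block of \<open>Q\<close> to be the removed trace; otherwise every zero block is inherited from
  \<open>Q\<close>.\<close>

lemma extend_blocks_typeB: "typeB_partition (Suc n) (extend_blocks n Q A)"
proof (rule typeB_partitionI)
  have "uminus ` A \<subseteq> pm_interval (Suc n)"
    using A_simps(2) by (metis image_mono uminus_pm_interval)
  moreover have "x \<in> \<Union>(extend_blocks n Q A)" if "x \<in> pm_interval n" for x
  proof -
    from that obtain B where "B \<in> Q" "x \<in> B"
      using typeB_Union[OF Q] by auto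
    then show ?thesis by (auto simp: extend_blocks_def)
  qed
  moreover have "int (Suc n) \<in> A" "- int (Suc n) \<in> uminus ` A"
    using A_simps(1) by (simp_all only: mem_uminus_image_iff minus_minus)
  moreover have "A \<in> extend_blocks n Q A" "uminus ` A \<in> extend_blocks n Q A"
    by (auto simp: extend_blocks_def)
  ultimately have "pm_interval (Suc n) \<subseteq> \<Union>(extend_blocks n Q A)"
    unfolding pm_interval_Suc by blast
  moreover have "\<Union>(extend_blocks n Q A) \<subseteq> pm_interval (Suc n)"
    using A_simps(2) \<open>uminus ` A \<subseteq> _\<close> typeB_subset[OF Q]
    unfolding extend_blocks_def pm_interval_Suc by blast
  ultimately show "\<Union>(extend_blocks n Q A) = pm_interval (Suc n)" by blast
  show "{} \<notin> extend_blocks n Q A"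
    using A_simps(1) typeB_nonempty[OF Q] by (auto simp: extend_blocks_def)
  show "B = C" if "B \<in> extend_blocks n Q A" "C \<in> extend_blocks n Q A" "x \<in> B" "x \<in> C" for B C x
  proof -
    \<comment> \<open>A kept block through \<open>x\<close> excludes \<open>x\<close> from
      \<open>A\<close> and \<open>-A\<close>, so the only mixed case left is \<open>A\<close>
      against \<open>-A\<close>.\<close>
    have cases: "B \<in> Q \<and> x \<notin> A \<and> x \<notin> uminus ` A \<or> B = A \<or> B = uminus ` A"
      if "B \<in> extend_blocks n Q A" "x \<in> B" for B
      using that disjoint_A[of B] disjoint_uminus_A[of B] unfolding extend_blocks_def by blast
    have overlap: "uminus ` A = A" if "x \<in> A" "x \<in> uminus ` A"
      using that A_cases by blast
    show ?thesis
      using cases[of B] cases[of C] that overlap typeB_eq[OF Q, of B C x] by metis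
  qed
  show "uminus ` B \<in> extend_blocks n Q A" if "B \<in> extend_blocks n Q A" for B
  proof (cases "B = A \<or> B = uminus ` A")
    case True
    then show ?thesis by (auto simp: extend_blocks_def)
  next
    case False
    with that have B: "B \<in> Q" "B \<noteq> pm_interval n \<inter> A" "B \<noteq> pm_interval n \<inter> uminus ` A"
      by (auto simp: extend_blocks_def)
    then have "uminus ` B \<noteq> pm_interval n \<inter> A" "uminus ` B \<noteq> pm_interval n \<inter> uminus ` A"
      by (simp_all add: uminus_image_eq_iff uminus_image_Int)
    with typeB_uminus[OF Q B(1)] show ?thesis
      by (simp add: extend_blocks_def)
  qed
  show "B = C" if BC: "B \<in> extend_blocks n Q A" "C \<in> extend_blocks n Q A"
    "uminus ` B = B" "uminus ` C = C" for B C
  proof (cases "uminus ` A = A")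
    case True
    then have "D = A" if "D \<in> extend_blocks n Q A" "uminus ` D = D" for D
      using A that by (auto simp: admissible_def extend_blocks_def)
    from this[OF BC(1,3)] this[OF BC(2,4)] show ?thesis by simp
  next
    case False
    then have "uminus ` uminus ` A \<noteq> uminus ` A" by simp
    with False have in_Q: "D \<in> Q" if "D \<in> extend_blocks n Q A" "uminus ` D = D" for D
      using that by (auto simp: extend_blocks_def)
    show ?thesis
      by (rule typeB_zero_unique[OF Q in_Q[OF BC(1,3)] in_Q[OF BC(2,4)] BC(3,4)])
  qed
qed

text \<open>Restriction turns \<open>A\<close> and \<open>-A\<close> back into the two removed
  traces; empty traces are discarded on both sides.\<close>

lemma restrict_extend_blocks: "restrict_blocks n (extend_blocks n Q A) = Q"
proof -
  have "pm_interval n \<inter> B = B" if "B \<in> Q" for B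
    using typeB_subset[OF Q that] by auto
  then have "(\<inter>) (pm_interval n) ` (Q - X) = Q - X" for X
    by force
  then have "restrict_blocks n (extend_blocks n Q A) =
    (Q - {pm_interval n \<inter> A, pm_interval n \<inter> uminus ` A} \<union>
       {pm_interval n \<inter> A, pm_interval n \<inter> uminus ` A}) - {{}}"
    by (simp add: restrict_blocks_def extend_blocks_def image_Un)
  then show ?thesis
    using A_simps(3,4) typeB_nonempty[OF Q] by auto
qed

lemma top_block_extend_blocks: "top_block n (extend_blocks n Q A) = A"
  unfolding top_block_def
proof (rule the_equality)
  show "A \<in> extend_blocks n Q A \<and> int (Suc n) \<in> A"
    using A_simps(1) by (simp add: extend_blocks_def)
  then show "B = A" if "B \<in> extend_blocks n Q A \<and> int (Suc n) \<in> B" for B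
    using that typeB_eq[OF extend_blocks_typeB] by blast
qed

end

section \<open>Restricting a partition of [n + 1]\<close>

context
  fixes n :: nat and P :: "int set set"
  assumes P: "typeB_partition (Suc n) P"
begin

private lemma top: "top_block n P \<in> P" "int (Suc n) \<in> top_block n P"
proof -
  have "int (Suc n) \<in> \<Union>P"
    using typeB_Union[OF P] by (simp add: mem_pm_interval)
  then obtain B where "B \<in> P" "int (Suc n) \<in> B" by auto
  then have "\<exists>!B. B \<in> P \<and> int (Suc n) \<in> B"
    using typeB_eq[OF P] by blast
  then show "top_block n P \<in> P" "int (Suc n) \<in> top_block n P"
    unfolding top_block_def by (metis (mono_tags, lifting) theI')+
qed

private lemma neg_top: "uminus ` top_block n P \<in> P" "- int (Suc n) \<in> uminus ` top_block n P"
  using typeB_uminus[OF P] top by (simp_all only: mem_uminus_image_iff minus_minus)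

private lemma not_top:
  assumes "B \<in> P" "B \<noteq> top_block n P" "B \<noteq> uminus ` top_block n P"
  shows "pm_interval n \<inter> B = B"
proof -
  have "int (Suc n) \<notin> B" "- int (Suc n) \<notin> B"
    using assms top neg_top typeB_eq[OF P] by blast+
  with typeB_subset[OF P \<open>B \<in> P\<close>] show ?thesis
    by (auto simp: pm_interval_Suc)
qed

text \<open>Restriction creates no new zero blocks: a symmetric trace is non-empty, so it has a
  point \<open>x\<close> lying in both \<open>B'\<close> and \<open>-B'\<close>, and two blocks that
  meet are equal.\<close>

private lemma zero_block_of_restriction:
  assumes "B \<in> restrict_blocks n P" "uminus ` B = B"
  obtains B' where "B' \<in> P" "uminus ` B' = B'" "B = pm_interval n \<inter> B'"
proof -
  from assms(1) obtain B' x where B': "B' \<in> P" "B = pm_interval n \<inter> B'" "x \<in> B"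
    by (auto simp: restrict_blocks_def)
  have "x \<in> uminus ` B"
    using B'(3) assms(2) by simp
  then have "x \<in> B'" "x \<in> uminus ` B'"
    using B' by auto
  then have "uminus ` B' = B'"
    by (rule typeB_eq[OF P typeB_uminus[OF P B'(1)] B'(1), rotated])
  with B' that show ?thesis by blast
qed

lemma restrict_blocks_typeB: "typeB_partition n (restrict_blocks n P)"
proof (rule typeB_partitionI)
  show "\<Union>(restrict_blocks n P) = pm_interval n"
  proof -
    have "\<Union>(restrict_blocks n P) = pm_interval n \<inter> \<Union>P"
      by (auto simp: restrict_blocks_def)
    then show ?thesis using typeB_Union[OF P] by (auto simp: pm_interval_Suc)
  qed
  show "{} \<notin> restrict_blocks n P"
    by (simp add: restrict_blocks_def)
  show "A = B" if "A \<in> restrict_blocks n P" "B \<in> restrict_blocks n P" "x \<in> A" "x \<in> B" for A B x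
    using that typeB_eq[OF P] by (auto simp: restrict_blocks_def)
  show "uminus ` B \<in> restrict_blocks n P" if "B \<in> restrict_blocks n P" for B
    using that typeB_uminus[OF P] by (auto simp: restrict_blocks_def uminus_image_Int)
  show "A = B" if AB: "A \<in> restrict_blocks n P" "B \<in> restrict_blocks n P"
    "uminus ` A = A" "uminus ` B = B" for A B
  proof -
    obtain A' where A': "A' \<in> P" "uminus ` A' = A'" "A = pm_interval n \<inter> A'"
      using zero_block_of_restriction[OF AB(1,3)] .
    obtain B' where B': "B' \<in> P" "uminus ` B' = B'" "B = pm_interval n \<inter> B'"
      using zero_block_of_restriction[OF AB(2,4)] .
    show ?thesis
      using A' B' typeB_zero_unique[OF P A'(1) B'(1)] by simp
  qed
qed

text \<open>If the top block is symmetric, it is the only zero block of \<open>P\<close>. A zero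
  block of the restriction comes from a zero block of \<open>P\<close>, hence is the trace of the
  top block.\<close>

lemma top_block_admissible: "top_block n P \<in> admissible n (restrict_blocks n P)"
proof -
  let ?A = "top_block n P"
  have "B = pm_interval n \<inter> ?A"
    if B: "B \<in> restrict_blocks n P" "uminus ` B = B" and A: "uminus ` ?A = ?A" for B
  proof -
    obtain B' where B': "B' \<in> P" "uminus ` B' = B'" "B = pm_interval n \<inter> B'"
      using zero_block_of_restriction[OF B] .
    then have "B' = ?A"
      using typeB_zero_unique[OF P B'(1) top(1) B'(2) A] by simp
    with B' show ?thesis by simp
  qed
  moreover have "?A \<inter> uminus ` ?A = {}" if "uminus ` ?A \<noteq> ?A"
    using that typeB_eq[OF P top(1) neg_top(1)] by blast
  moreover have "pm_interval n \<inter> ?A \<in> insert {} (restrict_blocks n P)"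
    using top(1) by (auto simp: restrict_blocks_def)
  ultimately show ?thesis
    unfolding admissible_def using top typeB_subset[OF P top(1)] by simp
qed

lemma extend_restrict_blocks: "extend_blocks n (restrict_blocks n P) (top_block n P) = P"
proof -
  let ?A = "top_block n P"
  let ?I = "(\<inter>) (pm_interval n)"
  let ?R = "P - {?A, uminus ` ?A}"
  have P_eq: "P = ?R \<union> {?A, uminus ` ?A}"
    using top neg_top by auto
  have "?I ` ?R = ?R"
    using not_top by force
  then have "?I ` P = ?R \<union> {?I ?A, ?I (uminus ` ?A)}"
    by (subst P_eq) (simp add: image_Un)
  then have "restrict_blocks n P - {?I ?A, ?I (uminus ` ?A)} =
      ?R - {{}} - {?I ?A, ?I (uminus ` ?A)}"
    unfolding restrict_blocks_def by auto
  also have "\<dots> = ?R"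
  proof -
    \<comment> \<open>A trace in \<open>?R\<close> would be a non-empty block of \<open>P\<close>
      meeting the top block or its negative, hence equal to it, but \<open>?R\<close> excludes
      both.\<close>
    have "?I ?A \<notin> ?R" "?I (uminus ` ?A) \<notin> ?R"
      using typeB_nonempty[OF P] typeB_eq[OF P top(1)] typeB_eq[OF P neg_top(1)] by blast+
    moreover have "{} \<notin> ?R"
      using typeB_nonempty[OF P] by auto
    ultimately show ?thesis by auto
  qed
  finally have "restrict_blocks n P - {?I ?A, ?I (uminus ` ?A)} = ?R" .
  then show ?thesis
    unfolding extend_blocks_def using P_eq by simp
qed

end

section \<open>Classifying and counting the admissible blocks\<close>

lemma Union_zero_blocks:
  assumes "typeB_partition n Q" "B \<in> Q" "uminus ` B = B"
  shows "\<Union>{B \<in> Q. uminus ` B = B} = B"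
proof -
  have "{B \<in> Q. uminus ` B = B} = {B}"
    using assms typeB_zero_unique[OF assms(1)] by auto
  then show ?thesis by simp
qed

lemma nonzero_block_Int_uminus:
  assumes "typeB_partition n Q" "B \<in> nonzero_blocks Q"
  shows "B \<inter> uminus ` B = {}"
  using assms typeB_eq[OF assms(1) _ typeB_uminus[OF assms(1)], of B B]
  by (auto simp: nonzero_blocks_def)

text \<open>A symmetric \<open>A\<close> contains both n + 1 and -(n + 1), and its trace is
  symmetric. Otherwise \<open>A\<close> is disjoint from \<open>-A\<close>, so it omits -(n + 1),
  and its trace is empty or a non-zero block.\<close>

lemma admissible_subset:
  assumes Q: "typeB_partition n Q" and A: "A \<in> admissible n Q"
  shows "A = \<Union>{B \<in> Q. uminus ` B = B} \<union> {int (Suc n), - int (Suc n)} \<or>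
    A = {int (Suc n)} \<or> A \<in> insert (int (Suc n)) ` nonzero_blocks Q"
proof (cases "uminus ` A = A")
  case True
  let ?C = "pm_interval n \<inter> A"
  have C: "uminus ` ?C = ?C"
    by (simp only: uminus_image_Int uminus_pm_interval True)
  have N: "int (Suc n) \<in> A"
    using A by (simp add: admissible_def)
  then have "int (Suc n) \<in> uminus ` A"
    using True by simp
  then have "- int (Suc n) \<in> A" by (simp only: mem_uminus_image_iff)
  moreover have "A \<subseteq> pm_interval (Suc n)"
    using A by (simp add: admissible_def)
  ultimately have A_eq: "A = ?C \<union> {int (Suc n), - int (Suc n)}"
    using N unfolding pm_interval_Suc by blast
  have "\<Union>{B \<in> Q. uminus ` B = B} = ?C"
  proof (cases "?C \<in> Q")
    case True
    then show ?thesis by (rule Union_zero_blocks[OF Q _ C])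
  next
    case False
    then have "?C = {}" using A by (auto simp: admissible_def)
    \<comment> \<open>With an empty trace this says that every zero block of \<open>Q\<close> is
      empty, and the union vanishes in any case.\<close>
    moreover have "\<forall>B\<in>Q. uminus ` B = B \<longrightarrow> B = ?C"
      using A True by (simp add: admissible_def)
    ultimately show ?thesis by auto
  qed
  with A_eq show ?thesis by simp
next
  case False
  let ?C = "pm_interval n \<inter> A"
  have disj: "A \<inter> uminus ` A = {}"
    using A False by (simp add: admissible_def)
  have N: "int (Suc n) \<in> A" "A \<subseteq> pm_interval (Suc n)" "?C = {} \<or> ?C \<in> Q"
    using A by (auto simp: admissible_def)
  have "- int (Suc n) \<in> uminus ` A"
    using N(1) by (simp only: mem_uminus_image_iff minus_minus)
  with disj have "- int (Suc n) \<notin> A" by blast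
  then have A_eq: "A = insert (int (Suc n)) ?C"
    using N unfolding pm_interval_Suc by blast
  show ?thesis
  proof (cases "?C = {}")
    case True
    then show ?thesis using A_eq by simp
  next
    case False
    then have "uminus ` ?C \<noteq> ?C"
      using disj by (auto simp: uminus_image_Int)
    with False N(3) have "?C \<in> nonzero_blocks Q"
      by (simp add: nonzero_blocks_def)
    with A_eq show ?thesis by blast
  qed
qed

text \<open>The union runs over at most one block. It is the zero block of \<open>Q\<close>, or
  empty if there is none, so a single term describes both cases.\<close>

lemma admissible_zero:
  assumes Q: "typeB_partition n Q"
  shows "\<Union>{B \<in> Q. uminus ` B = B} \<union> {int (Suc n), - int (Suc n)} \<in> admissible n Q"
proof -
  let ?Z = "\<Union>{B \<in> Q. uminus ` B = B}"
  let ?A = "?Z \<union> {int (Suc n), - int (Suc n)}"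
  have Z: "?Z \<subseteq> pm_interval n"
    using typeB_subset[OF Q] by auto
  then have I: "pm_interval n \<inter> ?A = ?Z"
    by (auto simp: mem_pm_interval)
  have "?Z \<in> insert {} Q"
  proof (cases "\<exists>B\<in>Q. uminus ` B = B")
    case True
    then show ?thesis using Union_zero_blocks[OF Q] by force
  next
    case False
    then have "?Z = {}" by blast
    then show ?thesis by simp
  qed
  moreover have "uminus ` ?Z = ?Z"
    unfolding image_Union by (rule arg_cong[where f = Union]) force
  then have "uminus ` ?A = ?A"
    unfolding image_Un by auto
  moreover have "\<forall>B\<in>Q. uminus ` B = B \<longrightarrow> B = ?Z"
    using Union_zero_blocks[OF Q] by simp
  moreover have "?A \<subseteq> pm_interval (Suc n)"
    using Z unfolding pm_interval_Suc by auto
  ultimately show ?thesis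
    unfolding admissible_def mem_Collect_eq I by simp
qed

lemma admissible_singleton: "{int (Suc n)} \<in> admissible n Q"
  by (auto simp: admissible_def mem_pm_interval)

lemma admissible_insert:
  assumes Q: "typeB_partition n Q" and B: "B \<in> nonzero_blocks Q"
  shows "insert (int (Suc n)) B \<in> admissible n Q" (is "?A \<in> _")
proof -
  have "B \<in> Q" using B by (simp add: nonzero_blocks_def)
  then have sub: "B \<subseteq> pm_interval n" by (rule typeB_subset[OF Q])
  then have I: "pm_interval n \<inter> ?A = B"
    by (auto simp: mem_pm_interval)
  have "int (Suc n) \<notin> uminus ` B" "- int (Suc n) \<notin> B"
    using sub by (auto simp: mem_pm_interval)
  then have disj: "?A \<inter> uminus ` ?A = {}"
    using nonzero_block_Int_uminus[OF Q B] by auto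
  then have "uminus ` ?A \<noteq> ?A" by auto
  moreover have "?A \<subseteq> pm_interval (Suc n)"
    using sub unfolding pm_interval_Suc by auto
  ultimately show ?thesis
    unfolding admissible_def mem_Collect_eq I using disj \<open>B \<in> Q\<close> by simp
qed

lemma admissible_eq:
  assumes "typeB_partition n Q"
  shows "admissible n Q =
    insert (\<Union>{B \<in> Q. uminus ` B = B} \<union> {int (Suc n), - int (Suc n)})
      (insert {int (Suc n)} (insert (int (Suc n)) ` nonzero_blocks Q))"
proof (rule subset_antisym; rule subsetI)
  fix A assume "A \<in> admissible n Q"
  from admissible_subset[OF assms this]
  show "A \<in> insert (\<Union>{B \<in> Q. uminus ` B = B} \<union> {int (Suc n), - int (Suc n)})
      (insert {int (Suc n)} (insert (int (Suc n)) ` nonzero_blocks Q))"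
    by (simp only: insert_iff)
next
  fix A assume "A \<in> insert (\<Union>{B \<in> Q. uminus ` B = B} \<union> {int (Suc n), - int (Suc n)})
      (insert {int (Suc n)} (insert (int (Suc n)) ` nonzero_blocks Q))"
  then show "A \<in> admissible n Q"
    using admissible_zero[OF assms] admissible_singleton admissible_insert[OF assms]
    by (elim insertE imageE) simp_all
qed

text \<open>The added block and the removed trace are both symmetric, so neither counts as a
  non-zero block.\<close>

lemma nonzero_blocks_extend_zero:
  assumes "uminus ` A = A"
  shows "nonzero_blocks (extend_blocks n Q A) = nonzero_blocks Q"
proof -
  have "uminus ` (pm_interval n \<inter> A) = pm_interval n \<inter> A"
    by (simp only: uminus_image_Int uminus_pm_interval assms)
  with assms show ?thesis
    by (auto simp: nonzero_blocks_def extend_blocks_def)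
qed

text \<open>\<open>A\<close> and \<open>-A\<close> are two distinct non-zero blocks, and they are
  new because they contain n + 1 and -(n + 1).\<close>

lemma card_nonzero_blocks_extend:
  assumes Q: "typeB_partition n Q" and A: "A \<in> admissible n Q" "uminus ` A \<noteq> A"
  shows "card (nonzero_blocks (extend_blocks n Q A)) =
    card (nonzero_blocks Q - {pm_interval n \<inter> A, pm_interval n \<inter> uminus ` A}) + 2"
proof -
  let ?R = "nonzero_blocks Q - {pm_interval n \<inter> A, pm_interval n \<inter> uminus ` A}"
  have "int (Suc n) \<in> A"
    using A by (simp add: admissible_def)
  then have "int (Suc n) \<in> A" "- int (Suc n) \<in> uminus ` A"
    by (simp_all only: mem_uminus_image_iff minus_minus)
  moreover have "int (Suc n) \<notin> pm_interval n" "- int (Suc n) \<notin> pm_interval n"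
    by (simp_all add: mem_pm_interval)
  ultimately have notin: "A \<notin> Q" "uminus ` A \<notin> Q"
    using typeB_subset[OF Q] by blast+
  have "uminus ` uminus ` A \<noteq> uminus ` A" using A(2) by simp
  then have "nonzero_blocks (extend_blocks n Q A) = insert A (insert (uminus ` A) ?R)"
    using A(2) by (auto simp: nonzero_blocks_def extend_blocks_def)
  moreover have "A \<notin> insert (uminus ` A) ?R" "uminus ` A \<notin> ?R"
    using A(2) notin by (auto simp: nonzero_blocks_def)
  moreover have "finite ?R"
    using typeB_finite[OF Q] by (simp add: nonzero_blocks_def)
  ultimately show ?thesis by simp
qed

text \<open>The singleton creates a new pair. The zero candidate and the 2 c enlarged non-zero
  blocks keep the number of pairs. The weight \<open>f\<close> is left general so that it can be
  \<open>fallB\<close> as well as a numerical indicator.\<close>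

lemma sum_admissible:
  fixes f :: "nat \<Rightarrow> 'a::comm_semiring_1"
  assumes Q: "typeB_partition n Q"
  defines "c \<equiv> card (nonzero_block_pairs Q)"
  shows "(\<Sum>A\<in>admissible n Q. f (card (nonzero_block_pairs (extend_blocks n Q A)))) =
    f (Suc c) + of_nat (2 * c + 1) * f c"
proof -
  let ?N = "int (Suc n)"
  let ?Z = "\<Union>{B \<in> Q. uminus ` B = B} \<union> {?N, - ?N}"
  let ?c = "\<lambda>A. card (nonzero_block_pairs (extend_blocks n Q A))"
  have card_Q: "card (nonzero_blocks Q) = 2 * c"
    using card_nonzero_blocks[OF Q] by (simp add: c_def)
  have card_ext: "2 * ?c A = card (nonzero_blocks (extend_blocks n Q A))"
    if "A \<in> admissible n Q" for A
    using card_nonzero_blocks[OF extend_blocks_typeB[OF Q that]] by simp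
  have fin: "finite (nonzero_blocks Q)"
    using typeB_finite[OF Q] by (simp add: nonzero_blocks_def)
  have notin: "?N \<notin> B" "- ?N \<notin> B" "B \<noteq> {}" if "B \<in> nonzero_blocks Q" for B
    using that typeB_subset[OF Q, of B] typeB_nonempty[OF Q, of B]
    by (auto simp: nonzero_blocks_def mem_pm_interval)
  have "uminus ` ?Z = ?Z"
  \<comment> \<open>For a non-symmetric set, admissibility demands disjointness from its negative,
    but \<open>?N\<close> lies in both.\<close>
  proof (rule ccontr)
    assume "uminus ` ?Z \<noteq> ?Z"
    then have "?Z \<inter> uminus ` ?Z = {}"
      using admissible_zero[OF Q] by (simp add: admissible_def)
    moreover have "?N \<in> ?Z" "?N \<in> uminus ` ?Z"
      unfolding mem_uminus_image_iff by blast+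
    ultimately show False by blast
  qed
  then have c1: "?c ?Z = c"
    using card_ext[OF admissible_zero[OF Q]] nonzero_blocks_extend_zero card_Q by simp
  have c2: "?c {?N} = Suc c"
  proof -
    have "{} \<notin> nonzero_blocks Q"
      using typeB_nonempty[OF Q] by (auto simp: nonzero_blocks_def)
    moreover have "pm_interval n \<inter> {?N} = {}" "pm_interval n \<inter> uminus ` {?N} = {}"
      by (auto simp: mem_pm_interval)
    ultimately show ?thesis
      using card_ext[OF admissible_singleton]
        card_nonzero_blocks_extend[OF Q admissible_singleton] card_Q by simp
  qed
  have c3: "?c (insert ?N B) = c" if B: "B \<in> nonzero_blocks Q" for B
  proof -
    let ?A = "insert ?N B"
    have adm: "?A \<in> admissible n Q"
      by (rule admissible_insert[OF Q B])
    have sub: "B \<subseteq> pm_interval n" and neg: "uminus ` B \<in> nonzero_blocks Q" and ne: "uminus ` B \<noteq> B"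
      using B typeB_subset[OF Q] typeB_uminus[OF Q]
      by (auto simp: nonzero_blocks_def uminus_image_eq_iff[of "uminus ` B"])
    have "?N \<notin> uminus ` ?A"
      using notin(2)[OF B] by (auto simp del: image_insert)
    then have "uminus ` ?A \<noteq> ?A" by blast
    note card_nonzero_blocks_extend[OF Q adm this]
    moreover have I: "pm_interval n \<inter> ?A = B"
      using sub by (auto simp: mem_pm_interval)
    moreover have "pm_interval n \<inter> uminus ` ?A = uminus ` B"
      using I by (metis uminus_image_Int uminus_pm_interval)
    moreover have "card (nonzero_blocks Q - {B, uminus ` B}) = 2 * c - 2"
      using fin B neg ne card_Q by (subst card_Diff_subset) (auto simp: card_insert_if)
    \<comment> \<open>This yields 2 <= 2 c, so the truncated difference 2 c - 2 plus the two new
      blocks gives 2 c.\<close>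
    moreover have "card {B, uminus ` B} \<le> card (nonzero_blocks Q)"
      using fin B neg by (intro card_mono) auto
    ultimately show ?thesis
      using card_ext[OF adm] card_Q ne by (simp add: card_insert_if)
  qed
  \<comment> \<open>The zero candidate is the only one containing \<open>- ?N\<close>, which
    separates it from the others.\<close>
  have "- ?N \<notin> A" if "A \<in> insert {?N} (insert ?N ` nonzero_blocks Q)" for A
    using that notin(2) by auto
  moreover have "- ?N \<in> ?Z" by blast
  ultimately have d1: "?Z \<notin> insert {?N} (insert ?N ` nonzero_blocks Q)"
    by blast
  have d2: "{?N} \<notin> insert ?N ` nonzero_blocks Q"
    using notin by auto
  have "inj_on (insert ?N) (nonzero_blocks Q)"
    using notin(1) by (intro inj_onI) (metis insert_ident)
  then have "(\<Sum>A\<in>insert ?N ` nonzero_blocks Q. f (?c A)) =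
      (\<Sum>B\<in>nonzero_blocks Q. f (?c (insert ?N B)))"
    by (simp only: sum.reindex o_def)
  also have "\<dots> = (\<Sum>B\<in>nonzero_blocks Q. f c)"
    by (intro sum.cong refl) (simp only: c3)
  also have "\<dots> = of_nat (2 * c) * f c"
    by (simp add: card_Q)
  finally have "(\<Sum>A\<in>insert ?N ` nonzero_blocks Q. f (?c A)) = of_nat (2 * c) * f c" .
  then show ?thesis
    unfolding admissible_eq[OF Q] using d1 d2 fin c1 c2
    by (simp del: image_insert add: algebra_simps)
qed

section \<open>The recurrence for weighted sums over partitions, and Bell polynomials as such
  sums\<close>

lemma sum_typeB_partition_Suc:
  fixes f :: "nat \<Rightarrow> 'a::comm_semiring_1"
  shows "(\<Sum>P | typeB_partition (Suc n) P. f (card (nonzero_block_pairs P))) =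
    (\<Sum>Q | typeB_partition n Q. f (Suc (card (nonzero_block_pairs Q))) +
       of_nat (2 * card (nonzero_block_pairs Q) + 1) * f (card (nonzero_block_pairs Q)))"
proof -
  \<comment> \<open>Restriction and extension are mutually inverse between the partitions
    \<open>P\<close> of [n + 1] and the pairs of a partition \<open>Q\<close> of [n] and an
    admissible \<open>A\<close>.\<close>
  have "(\<Sum>P | typeB_partition (Suc n) P. f (card (nonzero_block_pairs P))) =
    (\<Sum>(Q, A)\<in>Sigma {Q. typeB_partition n Q} (admissible n).
       f (card (nonzero_block_pairs (extend_blocks n Q A))))"
    by (rule sum.reindex_bij_witness[where i = "\<lambda>(Q, A). extend_blocks n Q A"
          and j = "\<lambda>P. (restrict_blocks n P, top_block n P)"])
      (auto simp: extend_restrict_blocks restrict_extend_blocks top_block_extend_blocks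
         restrict_blocks_typeB top_block_admissible extend_blocks_typeB)
  also have "\<dots> = (\<Sum>Q | typeB_partition n Q. \<Sum>A\<in>admissible n Q.
       f (card (nonzero_block_pairs (extend_blocks n Q A))))"
  proof (rule sum.Sigma[symmetric])
    show "\<forall>Q\<in>{Q. typeB_partition n Q}. finite (admissible n Q)"
      using typeB_finite by (auto simp: admissible_eq nonzero_blocks_def)
  qed (rule finite_typeB_partitions)
  also have "\<dots> = (\<Sum>Q | typeB_partition n Q. f (Suc (card (nonzero_block_pairs Q))) +
       of_nat (2 * card (nonzero_block_pairs Q) + 1) * f (card (nonzero_block_pairs Q)))"
    by (intro sum.cong refl sum_admissible) simp
  finally show ?thesis .
qed

lemma typeB_partition_0: "typeB_partition 0 P \<longleftrightarrow> P = {}"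
  by (auto simp: typeB_partition_def pm_interval_def partition_on_empty Uniq_def)

text \<open>This bound ensures that the range 0..n in \<open>BellB\<close> misses no
  partition.\<close>

lemma card_nonzero_block_pairs_le:
  "typeB_partition n P \<Longrightarrow> card (nonzero_block_pairs P) \<le> n"
proof (induction n arbitrary: P)
  case 0
  then show ?case by (simp add: typeB_partition_0 nonzero_block_pairs_def)
next
  case (Suc n)
  \<comment> \<open>The indicator of violating the bound. By induction c <= n, so the weights at c
    and c + 1 both vanish in the recurrence; a zero sum of naturals has only zero terms.\<close>
  let ?f = "\<lambda>k. if k \<le> Suc n then 0 else 1 :: nat"
  have "(\<Sum>P | typeB_partition (Suc n) P. ?f (card (nonzero_block_pairs P))) = 0"
    unfolding sum_typeB_partition_Suc[of ?f] by (rule sum.neutral) (use Suc.IH in force)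
  then have "\<forall>P\<in>{P. typeB_partition (Suc n) P}. ?f (card (nonzero_block_pairs P)) = 0"
    by (simp only: sum_eq_0_iff[OF finite_typeB_partitions])
  with Suc.prems have "?f (card (nonzero_block_pairs P)) = 0" by blast
  then show ?case by (simp split: if_splits)
qed

lemma BellB_eq_sum:
  "BellB n u = (\<Sum>P | typeB_partition n P. u ^ card (nonzero_block_pairs P))"
proof -
  let ?T = "{P. typeB_partition n P}"
  let ?c = "\<lambda>P. card (nonzero_block_pairs P)"
  have "BellB n u = (\<Sum>k=0..n. \<Sum>P | P \<in> ?T \<and> ?c P = k. u ^ ?c P)"
    by (simp add: BellB_def StirlingB_def)
  also have "\<dots> = (\<Sum>P\<in>?T. u ^ ?c P)"
    by (rule sum.group) (use finite_typeB_partitions card_nonzero_block_pairs_le in auto)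
  finally show ?thesis by simp
qed

section \<open>Powers of x in the basis \<open>fallB\<close>\<close>

lemma monom_eq_sum_fallB:
  "monom 1 n = (\<Sum>P | typeB_partition n P. fallB (card (nonzero_block_pairs P)))"
proof (induction n)
  case 0
  show ?case
    by (simp add: typeB_partition_0 nonzero_block_pairs_def fallB_def)
next
  case (Suc n)
  \<comment> \<open>Multiplication by x acts on \<open>fallB k\<close> exactly as the recurrence
    acts on the weight.\<close>
  have step: "fallB (Suc k) + of_nat (2 * k + 1) * fallB k = [:0, 1:] * fallB k" for k
  proof -
    have "fallB (Suc k) + of_nat (2 * k + 1) * fallB k =
        ([:- (2 * real k + 1), 1:] + [:2 * real k + 1:]) * fallB k"
      unfolding fallB_Suc of_nat_poly distrib_right by (simp add: mult.commute add.commute)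
    also have "\<dots> = [:0, 1:] * fallB k"
      by (simp only: add_pCons) simp
    finally show ?thesis .
  qed
  show ?case
    unfolding sum_typeB_partition_Suc step sum_distrib_left[symmetric] Suc.IH[symmetric]
    by (simp add: monom_Suc)
qed

text \<open>Replacing x by x - 2 moves the roots 1, 3, ..., 2 k - 1 to 3, 5, ..., 2 k + 1, and the
  factor x - 1 supplies the root 1. The induction splits off the largest root.\<close>

lemma poly_fallB_Suc: "poly (fallB (Suc k)) x = (x - 1) * poly (fallB k) (x - 2)"
proof (induction k)
  case 0
  show ?case by (simp add: fallB_def)
next
  case (Suc k)
  have "poly (fallB (Suc (Suc k))) x = poly (fallB (Suc k)) x * (x - (2 * real (Suc k) + 1))"
    unfolding fallB_Suc[of "Suc k"] poly_mult by simp
  also have "\<dots> = (x - 1) * (poly (fallB k) (x - 2) * (x - 2 - (2 * real k + 1)))"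
    unfolding Suc.IH by (simp add: algebra_simps)
  also have "\<dots> = (x - 1) * poly (fallB (Suc k)) (x - 2)"
    unfolding fallB_Suc[of k] poly_mult by simp
  finally show ?case .
qed

lemma monom_Suc_eq_sum_fallB:
  "monom 1 (Suc n) = monom 1 n + (\<Sum>j=0..n. smult (2 ^ (n - j) * real (n choose j))
     (\<Sum>P | typeB_partition j P. fallB (Suc (card (nonzero_block_pairs P)))))"
proof (rule poly_ext)
  fix x :: real
  \<comment> \<open>The expansion of the power, evaluated at a point \<open>y\<close>; it is used
    with \<open>y\<close> = x - 2.\<close>
  have pow: "(\<Sum>P | typeB_partition j P. poly (fallB (card (nonzero_block_pairs P))) y) = y ^ j"
    for j y
    using arg_cong[OF monom_eq_sum_fallB[of j], of "\<lambda>p. poly p y"]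
    by (simp add: poly_sum poly_monom)
  have "x ^ n = (x - 2 + 2) ^ n" by simp
  also have "\<dots> = (\<Sum>j=0..n. 2 ^ (n - j) * real (n choose j) * (x - 2) ^ j)"
    unfolding binomial_ring by (simp add: atMost_atLeast0 mult_ac)
  finally have "(x - 1) * x ^ n =
      (\<Sum>j=0..n. 2 ^ (n - j) * real (n choose j) * ((x - 1) * (x - 2) ^ j))"
    by (simp only: sum_distrib_left mult_ac)
  then have "x ^ Suc n = x ^ n +
      (\<Sum>j=0..n. 2 ^ (n - j) * real (n choose j) * ((x - 1) * (x - 2) ^ j))"
    by (simp add: left_diff_distrib)
  then show "poly (monom 1 (Suc n)) x = poly (monom 1 n + (\<Sum>j=0..n.
      smult (2 ^ (n - j) * real (n choose j))
       (\<Sum>P | typeB_partition j P. fallB (Suc (card (nonzero_block_pairs P)))))) x"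
    by (simp add: poly_monom poly_sum poly_fallB_Suc pow flip: sum_distrib_left)
qed

theorem theorem3p2:
  fixes u :: real and n :: nat
  shows "BellB n u = functionalB u (monom 1 n) \<and>
    BellB (n + 1) u =
      BellB n u + u * (\<Sum>j=0..n. 2 ^ (n - j) * real (n choose j) * BellB j u)"
proof -
  define L where "L = functionalB u"
  have L: "is_functionalB u L"
    unfolding L_def by (rule is_functionalB_functionalB)
  then have L_add: "L (p + q) = L p + L q" and L_smult: "L (smult c p) = c * L p"
    and L_fallB: "L (fallB k) = u ^ k" for p q c k
    by (auto simp: is_functionalB_def linear_poly_functional_iff)
  have L_0: "L 0 = 0" using L_smult[of 0 0] by simp
  \<comment> \<open>Both kinds of sums in \<open>monom_Suc_eq_sum_fallB\<close> must pass through
    \<open>L\<close>: over the exponent \<open>j\<close>, and over partitions.\<close>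
  have L_sum_nat: "L (sum f A) = (\<Sum>a\<in>A. L (f a))" for f and A :: "nat set"
    by (induction A rule: infinite_finite_induct) (simp_all add: L_0 L_add)
  have L_sum_partitions: "L (sum f A) = (\<Sum>a\<in>A. L (f a))" for f and A :: "int set set set"
    by (induction A rule: infinite_finite_induct) (simp_all add: L_0 L_add)
  have moment: "BellB m u = L (monom 1 m)" for m
    unfolding BellB_eq_sum monom_eq_sum_fallB L_sum_partitions L_fallB by simp
  have "BellB (n + 1) u = L (monom 1 (Suc n))" by (simp add: moment)
  \<comment> \<open>The raised index of \<open>fallB (Suc c)\<close> produces the factor
    \<open>u\<close>, since \<open>L\<close> maps it to \<open>u * u ^ c\<close>.\<close>
  also have "\<dots> = BellB n u +
      (\<Sum>j=0..n. 2 ^ (n - j) * real (n choose j) * (u * BellB j u))"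
    unfolding monom_Suc_eq_sum_fallB L_add L_sum_nat L_smult L_sum_partitions L_fallB
      moment[symmetric] BellB_eq_sum
    by (simp add: sum_distrib_left)
  finally show ?thesis
    using moment[of n] by (simp add: L_def sum_distrib_left mult_ac)
qed

end
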